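(* Let $G$ be a connected graph. Then for any graph $H$, the corona product $G\circ H$ satisfies $$CC(G\circ H)=\begin{cases}2, & \text{if } |V(G)|\geq 2,\\ 0, & \text{if } |V(G)|=1 \text{ and } CC(H)=0,\\ 1+CC(H), & \text{if } |V(G)|=1 \text{ and } CC(H)\neq 0.\end{cases}$$
   Context: All graphs are finite and simple, with nonempty vertex set. The corona product $G\circ H$ is the graph obtained by taking one copy of $G$ and $|V(G)|$ copies of $H$ and joining the $i$-th vertex of $G$ to every vertex of the $i$-th copy of $H$. A full vertex of $G$ is a vertex of degree $|V(G)|-1$. A set $S\subseteq V(G)$ is a dominating set of $G$ if every vertex of $V(G)\setminus S$ has a neighbour in $S$; it is a connected dominating set if moreover the induced subgraph $G[S]$ is connected. Two disjoint vertex sets $A_1,A_2$ form a connected coalition of $G$ if $A_1\cup A_2$ is a connected dominating set of $G$ but neither $A_1$ nor $A_2$ is a connected dominating set of $G$. A connected coalition partition of $G$ is a partition $\Phi$ of $V(G)$ (into nonempty sets) such that each $A\in\Phi$ either is $\{v\}$ for some full vertex $v$ of $G$, or forms a connected coalition of $G$ with another set in $\Phi$. The connected coalition number $CC(G)$ is the maximum cardinality of a connected coalition partition of $G$, with $CC(G)=0$ if none exists. *)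

theory Defs
  imports "Graph_Theory.Digraph_Component" "HOL-Library.Disjoint_Sets"
begin

text \<open>
  Finite simple graphs are the library's \<^locale>\<open>pair_graph\<close>: finite, loop-free, symmetric
  digraphs whose arcs are pairs of vertices, so that each undirected edge is a pair of opposite
  arcs and the degree of a vertex is its out-degree.
\<close>

text \<open>
  The vertex \<open>Inl g\<close> is the vertex \<open>g\<close> of \<open>G\<close>, and \<open>Inr (g, h)\<close> is the vertex \<open>h\<close> in the copy
  of \<open>H\<close> attached to \<open>g\<close>.
\<close>

definition corona ::
  "'a pair_pre_digraph \<Rightarrow> 'b pair_pre_digraph \<Rightarrow> ('a + 'a \<times> 'b) pair_pre_digraph" where
  "corona G H =
     \<lparr> pverts = pverts G <+> (pverts G \<times> pverts H),
       parcs = {(Inl g, Inl g') | g g'. (g, g') \<in> parcs G}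
             \<union> {(Inr (g, h), Inr (g, h')) | g h h'. g \<in> pverts G \<and> (h, h') \<in> parcs H}
             \<union> {(Inl g, Inr (g, h)) | g h. g \<in> pverts G \<and> h \<in> pverts H}
             \<union> {(Inr (g, h), Inl g) | g h. g \<in> pverts G \<and> h \<in> pverts H} \<rparr>"

definition full_vertex :: "'a pair_pre_digraph \<Rightarrow> 'a \<Rightarrow> bool" where
  "full_vertex G v \<longleftrightarrow> v \<in> pverts G \<and> out_degree (with_proj G) v = card (pverts G) - 1"

definition dominating_set :: "'a pair_pre_digraph \<Rightarrow> 'a set \<Rightarrow> bool" where
  "dominating_set G S \<longleftrightarrow>
     S \<subseteq> pverts G \<and> (\<forall>v \<in> pverts G - S. \<exists>u \<in> S. (v, u) \<in> parcs G)"

definition connected_dominating_set :: "'a pair_pre_digraph \<Rightarrow> 'a set \<Rightarrow> bool" where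
  "connected_dominating_set G S \<longleftrightarrow>
     dominating_set G S \<and> Digraph_Component.connected (with_proj G \<restriction> S)"

definition connected_coalition :: "'a pair_pre_digraph \<Rightarrow> 'a set \<Rightarrow> 'a set \<Rightarrow> bool" where
  "connected_coalition G A B \<longleftrightarrow>
     A \<subseteq> pverts G \<and> B \<subseteq> pverts G \<and> A \<inter> B = {} \<and>
     connected_dominating_set G (A \<union> B) \<and>
     \<not> connected_dominating_set G A \<and> \<not> connected_dominating_set G B"

definition connected_coalition_partition :: "'a pair_pre_digraph \<Rightarrow> 'a set set \<Rightarrow> bool" where
  "connected_coalition_partition G \<Phi> \<longleftrightarrow>
     partition_on (pverts G) \<Phi> \<and>
     (\<forall>A \<in> \<Phi>. (\<exists>v. full_vertex G v \<and> A = {v}) \<or>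
              (\<exists>B \<in> \<Phi> - {A}. connected_coalition G A B))"

definition CC :: "'a pair_pre_digraph \<Rightarrow> nat" where
  "CC G = (if \<exists>\<Phi>. connected_coalition_partition G \<Phi>
           then Max {card \<Phi> | \<Phi>. connected_coalition_partition G \<Phi>}
           else 0)"

lemma pair_graph_corona:
  assumes "pair_graph G" "pair_graph H"
  shows "pair_graph (corona G H)"
proof -
  interpret G: pair_graph G by fact
  interpret H: pair_graph H by fact
  have wf: "fst e \<in> pverts (corona G H)" "snd e \<in> pverts (corona G H)" "fst e \<noteq> snd e"
    if "e \<in> parcs (corona G H)" for e
    using that by (auto simp: corona_def dest: G.in_arcsD1 G.in_arcsD2 H.in_arcsD1 H.in_arcsD2
        G.pair_no_loops H.pair_no_loops)
  have fin: "finite (pverts (corona G H))"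
    by (simp add: corona_def G.pair_finite_verts H.pair_finite_verts)
  have "parcs (corona G H) \<subseteq> pverts (corona G H) \<times> pverts (corona G H)"
    using wf by (metis mem_Times_iff subsetI)
  then have fin': "finite (parcs (corona G H))"
    using fin by (meson finite_SigmaI finite_subset)
  have "sym (parcs G)" "sym (parcs H)"
    using G.pair_sym_arcs H.pair_sym_arcs by (simp_all add: symmetric_def)
  then have "sym (parcs (corona G H))"
    unfolding sym_def corona_def by auto
  then show ?thesis
    using wf fin fin' by unfold_locales (auto simp: symmetric_def)
qed

lemma finite_card_connected_coalition_partition:
  assumes "pair_graph G"
  shows "finite {card \<Phi> | \<Phi>. connected_coalition_partition G \<Phi>}"
proof -
  interpret pair_graph G by fact
  have "{card \<Phi> | \<Phi>. connected_coalition_partition G \<Phi>} \<subseteq> card ` Pow (Pow (pverts G))"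
    by (auto simp: connected_coalition_partition_def partition_on_def)
  then show ?thesis
    by (rule finite_subset) (simp add: pair_finite_verts)
qed

end

theory Submission
  imports Defs
begin

text \<open>
  If \<open>G\<close> has at least two vertices, the connected dominating sets of the corona are exactly the
  vertex sets that contain all of \<open>V(G)\<close>: a copy of \<open>H\<close> communicates with the rest only through
  its vertex of \<open>G\<close>. As no vertex is full, the first two members of a coalition already cover
  \<open>V(G)\<close>, and a third block would have to form a coalition with a set containing \<open>V(G)\<close>.
  If \<open>G\<close> is a single vertex \<open>g\<close>, every set containing \<open>g\<close> is connected dominating, so \<open>{g}\<close> is a
  block of every connected coalition partition, and removing it gives a connected coalition
  partition of \<open>H\<close>.
\<close>

section \<open>Connectedness and full vertices\<close>

text \<open>A path is pushed forward arc by arc. Later instances of \<open>f\<close> are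
  \<open>id\<close> with a smaller relation, the embedding \<open>Inl\<close> of the base graph, and
  the inverse of an injection.\<close>

lemma rtrancl_on_image:
  assumes "(x, y) \<in> rtrancl_on S r"
    and "\<And>x y. x \<in> S \<Longrightarrow> y \<in> S \<Longrightarrow> (x, y) \<in> r \<Longrightarrow> (f x, f y) \<in> r'"
  shows "(f x, f y) \<in> rtrancl_on (f ` S) r'"
  using assms(1)
proof (induction rule: rtrancl_on_induct)
  case base
  then show ?case by simp
next
  case (step y z)
  then show ?case by (meson assms(2) imageI rtrancl_on_into_rtrancl_on)
qed

lemma rtrancl_on_image_iff:
  assumes inj: "inj_on f S" and S: "x \<in> S" "y \<in> S"
    and rel: "\<And>x y. x \<in> S \<Longrightarrow> y \<in> S \<Longrightarrow> (f x, f y) \<in> r' \<longleftrightarrow> (x, y) \<in> r"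
  shows "(f x, f y) \<in> rtrancl_on (f ` S) r' \<longleftrightarrow> (x, y) \<in> rtrancl_on S r"
proof
  assume "(f x, f y) \<in> rtrancl_on (f ` S) r'"
  \<comment> \<open>Injectivity makes \<open>inv_into S f\<close> a left inverse on
    \<open>S\<close>, so the same transport lemma also carries paths back.\<close>
  then have "(inv_into S f (f x), inv_into S f (f y)) \<in> rtrancl_on (inv_into S f ` f ` S) r"
    by (rule rtrancl_on_image) (auto simp: inj rel)
  then show "(x, y) \<in> rtrancl_on S r"
    using inj S by simp
next
  assume "(x, y) \<in> rtrancl_on S r"
  then show "(f x, f y) \<in> rtrancl_on (f ` S) r'"
    by (rule rtrancl_on_image) (simp add: rel)
qed

text \<open>The arcs are symmetric already, so \<open>mk_symmetric\<close> adds nothing to them.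
  Paths of \<open>rtrancl_on S\<close> never leave \<open>S\<close>, so the relation need not be cut
  down to \<open>S \<times> S\<close>.\<close>

lemma connected_induce_iff:
  assumes "pair_graph G"
  shows "Digraph_Component.connected (with_proj G \<restriction> S) \<longleftrightarrow>
    S \<noteq> {} \<and> (\<forall>u \<in> S. \<forall>v \<in> S. (u, v) \<in> rtrancl_on S (parcs G))"
proof -
  interpret pair_graph G by fact
  have "sym (parcs G)"
    using pair_sym_arcs by (simp add: symmetric_def)
  then have eq: "parcs (mk_symmetric (with_proj G \<restriction> S)) = parcs G \<inter> S \<times> S"
    by (auto simp: parcs_mk_symmetric dest: symD)
  have "(u, v) \<in> rtrancl_on S (parcs G \<inter> S \<times> S) \<longleftrightarrow> (u, v) \<in> rtrancl_on S (parcs G)" for u v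
    using rtrancl_on_image[of u v S "parcs G" id "parcs G \<inter> S \<times> S"]
      rtrancl_on_mono[of "parcs G \<inter> S \<times> S" "parcs G" S S u v] by auto
  then show ?thesis
    by (auto simp: connected_def strongly_connected_def reachable_def eq)
qed

text \<open>Makes \<open>connected_induce_iff\<close> applicable to the connectedness of the whole
  graph.\<close>

lemma induce_pverts:
  assumes "pair_graph G"
  shows "with_proj G \<restriction> pverts G = with_proj G"
proof -
  interpret pair_graph G by fact
  show ?thesis
    by (auto simp: induce_subgraph_def with_proj_def dest: in_arcsD1 in_arcsD2)
qed

lemma ex_other_if_two_le_card:
  assumes "finite A" "card A \<ge> 2"
  shows "\<exists>y \<in> A. y \<noteq> x"
proof (rule ccontr)
  assume "\<not> (\<exists>y \<in> A. y \<noteq> x)"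
  then have "A \<subseteq> {x}" by blast
  then show False
    using assms card_mono[of "{x}" A] by simp
qed

text \<open>Without loops the out-neighbourhood of \<open>v\<close> lies in
  \<open>pverts G - {v}\<close>. For finite sets, having the size of that set then means being equal
  to it.\<close>

lemma full_vertex_iff:
  assumes "pair_graph G"
  shows "full_vertex G v \<longleftrightarrow> v \<in> pverts G \<and> (\<forall>w \<in> pverts G - {v}. (v, w) \<in> parcs G)"
proof -
  interpret pair_graph G by fact
  define N where "N = {w. (v, w) \<in> parcs G}"
  have "out_arcs (with_proj G) v = Pair v ` N"
    by (auto simp: out_arcs_def N_def)
  then have deg: "out_degree (with_proj G) v = card N"
    by (simp add: out_degree_def card_image inj_on_def)
  have sub: "N \<subseteq> pverts G - {v}"
    unfolding N_def using arc_snd_in_verts pair_no_loops by fastforce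
  have "card N = card (pverts G) - 1 \<longleftrightarrow> N = pverts G - {v}" if "v \<in> pverts G"
    using that sub pair_finite_verts
    by (metis card_Diff_singleton card_subset_eq finite_Diff)
  then show ?thesis
    using sub by (auto simp: full_vertex_def deg N_def)
qed

section \<open>The corona product\<close>

lemma pverts_corona: "pverts (corona G H) = pverts G <+> pverts G \<times> pverts H"
  by (simp add: corona_def)

lemma parcs_corona_iff [simp]:
  "(Inl g, Inl g') \<in> parcs (corona G H) \<longleftrightarrow> (g, g') \<in> parcs G"
  "(Inl g, Inr (g', h)) \<in> parcs (corona G H) \<longleftrightarrow> g' = g \<and> g \<in> pverts G \<and> h \<in> pverts H"
  "(Inr (g', h), Inl g) \<in> parcs (corona G H) \<longleftrightarrow> g' = g \<and> g \<in> pverts G \<and> h \<in> pverts H"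
  "(Inr (g, h), Inr (g', h')) \<in> parcs (corona G H) \<longleftrightarrow>
     g' = g \<and> g \<in> pverts G \<and> (h, h') \<in> parcs H"
  by (auto simp: corona_def)

text \<open>A second base vertex \<open>g'\<close> supplies the missing neighbour:
  \<open>Inl g\<close> is not adjacent to the copy over \<open>g'\<close>, and no vertex of the copy
  over \<open>g\<close> is adjacent to \<open>Inl g'\<close>.\<close>

lemma not_full_vertex_corona:
  assumes "pair_graph G" "pair_graph H" "pverts H \<noteq> {}" "card (pverts G) \<ge> 2"
  shows "\<not> full_vertex (corona G H) x"
proof
  assume full: "full_vertex (corona G H) x"
  interpret G: pair_graph G by fact
  obtain h where h: "h \<in> pverts H" using assms by blast
  have ex: "\<exists>g' \<in> pverts G. g' \<noteq> g" for g
    using assms(4) G.pair_finite_verts by (rule ex_other_if_two_le_card[rotated])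
  note full' = full[unfolded full_vertex_iff[OF pair_graph_corona[OF assms(1,2)]]]
  show False
  proof (cases x)
    case (Inl g)
    obtain g' where "g' \<in> pverts G" "g' \<noteq> g" using ex by blast
    then have "Inr (g', h) \<in> pverts (corona G H) - {x}" "(x, Inr (g', h)) \<notin> parcs (corona G H)"
      using h Inl by (auto simp: pverts_corona)
    then show False using full' by blast
  next
    case (Inr p)
    obtain g h' where p: "p = (g, h')" by fastforce
    obtain g' where "g' \<in> pverts G" "g' \<noteq> g" using ex by blast
    then have "Inl g' \<in> pverts (corona G H) - {x}" "(x, Inl g') \<notin> parcs (corona G H)"
      using Inr p by (auto simp: pverts_corona)
    then show False using full' by blast
  qed
qed

text \<open>If \<open>Inl g\<close> were missing, domination would put members of \<open>S\<close>
  both inside and outside the copy over \<open>g\<close>, yet every path between them passes through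
  \<open>Inl g\<close>.\<close>

lemma Inl_subset_if_connected_dominating_set_corona:
  assumes "pair_graph G" "pair_graph H" "pverts H \<noteq> {}" "card (pverts G) \<ge> 2"
    and S: "connected_dominating_set (corona G H) S"
  shows "Inl ` pverts G \<subseteq> S"
proof (rule ccontr)
  assume "\<not> Inl ` pverts G \<subseteq> S"
  then obtain g where g: "g \<in> pverts G" "Inl g \<notin> S" by blast
  interpret G: pair_graph G by fact
  obtain g' where g': "g' \<in> pverts G" "g' \<noteq> g"
    using ex_other_if_two_le_card[OF G.pair_finite_verts assms(4)] by blast
  have dom: "v \<in> S \<or> (\<exists>u \<in> S. (v, u) \<in> parcs (corona G H))" if "v \<in> pverts (corona G H)" for v
    using that S by (auto simp: connected_dominating_set_def dominating_set_def)
  obtain h where h: "h \<in> pverts H" using assms by blast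
  have "Inr (g, h) \<in> S \<or> (\<exists>u \<in> S. (Inr (g, h), u) \<in> parcs (corona G H))"
    using g h by (intro dom) (auto simp: pverts_corona)
  then obtain k where k: "Inr (g, k) \<in> S"
  proof (elim disjE bexE)
    fix u assume u: "u \<in> S" "(Inr (g, h), u) \<in> parcs (corona G H)"
    then show thesis
      using that g by (cases u) auto
  qed
  \<comment> \<open>Neither \<open>Inl g'\<close> nor any of its neighbours lies in the copy over
    \<open>g\<close>, so dominating \<open>Inl g'\<close> yields a member of \<open>S\<close>
    outside that copy.\<close>
  have "Inl g' \<in> S \<or> (\<exists>u \<in> S. (Inl g', u) \<in> parcs (corona G H))"
    using g' by (intro dom) (auto simp: pverts_corona)
  then obtain x where x: "x \<in> S" "x \<notin> range (\<lambda>h. Inr (g, h))"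
  proof (elim disjE bexE)
    fix u assume u: "u \<in> S" "(Inl g', u) \<in> parcs (corona G H)"
    then show thesis
      using that[of u] g' by (cases u) (auto simp: image_iff)
  qed (use that in auto)
  have "(Inr (g, k), x) \<in> rtrancl_on S (parcs (corona G H))"
    using S k x connected_induce_iff[OF pair_graph_corona[OF assms(1,2)], of S]
    by (simp add: connected_dominating_set_def)
  \<comment> \<open>Invariant along the path: an arc leaving the copy over \<open>g\<close> could
    only end in \<open>Inl g\<close>, which is not in \<open>S\<close>.\<close>
  then have "x \<in> range (\<lambda>h. Inr (g, h))"
  proof (induction rule: rtrancl_on_induct)
    case (step y z)
    then show ?case
      using g by (cases z) auto
  qed auto
  then show False using x by blast
qed

text \<open>Each copy vertex is adjacent to its base vertex, which gives domination. Two members of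
  \<open>S\<close> are joined by going to the base, through it and out again.\<close>

lemma connected_dominating_set_corona_if_Inl_subset:
  assumes "pair_graph G" "pair_graph H" "pverts G \<noteq> {}"
    and conn: "Digraph_Component.connected (with_proj G)"
    and S: "Inl ` pverts G \<subseteq> S" "S \<subseteq> pverts (corona G H)"
  shows "connected_dominating_set (corona G H) S"
proof -
  let ?E = "parcs (corona G H)"
  have "\<exists>u \<in> S. (v, u) \<in> ?E" if v: "v \<in> pverts (corona G H) - S" for v
  proof -
    obtain g h where "v = Inr (g, h)" "g \<in> pverts G" "h \<in> pverts H"
      using v S(1) by (auto simp: pverts_corona)
    then show ?thesis
      using S(1) by (intro bexI[of _ "Inl g"]) auto
  qed
  then have dom: "dominating_set (corona G H) S"
    using S(2) by (auto simp: dominating_set_def)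
  have core: "(Inl g, Inl g') \<in> rtrancl_on S ?E" if "g \<in> pverts G" "g' \<in> pverts G" for g g'
  proof -
    have "(g, g') \<in> rtrancl_on (pverts G) (parcs G)"
      using conn that connected_induce_iff[OF assms(1), of "pverts G"]
      by (simp add: induce_pverts[OF assms(1)])
    then have "(Inl g, Inl g') \<in> rtrancl_on (Inl ` pverts G) ?E"
      by (rule rtrancl_on_image) simp
    then show ?thesis
      by (rule rtrancl_on_mono[OF subset_refl S(1)])
  qed
  \<comment> \<open>Both directions are recorded because the joining path enters the base from one
    endpoint and leaves it towards the other.\<close>
  have to_core: "\<exists>g \<in> pverts G. (x, Inl g) \<in> rtrancl_on S ?E \<and> (Inl g, x) \<in> rtrancl_on S ?E"
    if x: "x \<in> S" for x
  proof (cases x)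
    case (Inl g)
    then show ?thesis
      using x S(2) core[of g g] by (auto simp: pverts_corona)
  next
    case (Inr p)
    then obtain g h where gh: "x = Inr (g, h)" "g \<in> pverts G" "h \<in> pverts H"
      using x S(2) by (auto simp: pverts_corona)
    then have "Inl g \<in> S" "(x, Inl g) \<in> ?E" "(Inl g, x) \<in> ?E"
      using S(1) by auto
    then show ?thesis
      using x gh(2) by (meson rtrancl_on_into_rtrancl_on rtrancl_on_refl)
  qed
  have "(u, v) \<in> rtrancl_on S ?E" if "u \<in> S" "v \<in> S" for u v
    using to_core[OF that(1)] to_core[OF that(2)] core by (meson rtrancl_on_trans)
  then show ?thesis
    using dom S(1) assms(3) connected_induce_iff[OF pair_graph_corona[OF assms(1,2)], of S]
    by (auto simp: connected_dominating_set_def)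
qed

section \<open>Evaluating the coalition number\<close>

lemma CC_eqI:
  assumes "connected_coalition_partition G \<Phi>"
    and "\<And>\<Psi>. connected_coalition_partition G \<Psi> \<Longrightarrow> card \<Psi> = card \<Phi>"
  shows "CC G = card \<Phi>"
proof -
  have "{card \<Psi> | \<Psi>. connected_coalition_partition G \<Psi>} = {card \<Phi>}"
    using assms by blast
  then show ?thesis
    using assms(1) by (auto simp: CC_def)
qed

text \<open>A partition of a nonempty vertex set has at least one block, so the default value 0 is
  never a genuine maximum and \<open>CC H = 0\<close> expresses nonexistence.\<close>

lemma CC_eq_0_iff:
  assumes H: "pair_graph H" and nonempty: "pverts H \<noteq> {}"
  shows "CC H = 0 \<longleftrightarrow> \<not> (\<exists>\<Phi>. connected_coalition_partition H \<Phi>)"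
proof -
  interpret H: pair_graph H by (rule H)
  have "0 < CC H" if \<Phi>: "connected_coalition_partition H \<Phi>" for \<Phi>
  proof -
    have "partition_on (pverts H) \<Phi>"
      using \<Phi> by (simp add: connected_coalition_partition_def)
    moreover from this have "finite \<Phi>"
      by (rule finite_elements[OF H.pair_finite_verts])
    ultimately have "finite \<Phi>" "\<Phi> \<noteq> {}"
      using nonempty by (auto simp: partition_on_def)
    then have "0 < card \<Phi>" by (simp add: card_gt_0_iff)
    also have "card \<Phi> \<le> CC H"
      using \<Phi> finite_card_connected_coalition_partition[OF H] by (auto simp: CC_def intro: Max_ge)
    finally show ?thesis .
  qed
  then show ?thesis by (metis CC_def less_irrefl)
qed

section \<open>Base graphs with at least two vertices\<close>

lemma CC_corona_if_two_le_card:
  assumes GH: "pair_graph G" "pair_graph H" and H: "pverts H \<noteq> {}"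
    and conn: "Digraph_Component.connected (with_proj G)" and card: "card (pverts G) \<ge> 2"
  shows "CC (corona G H) = 2"
proof -
  let ?C = "corona G H"
  interpret G: pair_graph G by fact
  obtain g g' where g: "g \<in> pverts G" "g' \<in> pverts G" "g' \<noteq> g"
    using ex_other_if_two_le_card[OF G.pair_finite_verts card] by metis
  have cds: "connected_dominating_set ?C S \<longleftrightarrow> Inl ` pverts G \<subseteq> S \<and> S \<subseteq> pverts ?C" for S
    using Inl_subset_if_connected_dominating_set_corona[OF GH H card, of S]
      connected_dominating_set_corona_if_Inl_subset[OF GH _ conn, of S] g
    by (auto simp: connected_dominating_set_def dominating_set_def)
  \<comment> \<open>Splitting the base is all that matters: \<open>A\<close> lacks
    \<open>Inl g'\<close>, \<open>B\<close> lacks \<open>Inl g\<close>, and together they contain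
    every vertex.\<close>
  define A where "A = {Inl g :: 'a + 'a \<times> 'b}"
  define B where "B = pverts ?C - A"
  have mem: "Inl g \<in> pverts ?C" "Inl g' \<in> pverts ?C"
    using g by (auto simp: pverts_corona)
  have AB: "A \<union> B = pverts ?C" "A \<inter> B = {}" "A \<noteq> B" "A \<noteq> {}" "B \<noteq> {}"
    using mem g by (auto simp: A_def B_def)
  have "\<not> Inl ` pverts G \<subseteq> A" "\<not> Inl ` pverts G \<subseteq> B" "Inl ` pverts G \<subseteq> pverts ?C"
    using g by (auto simp: A_def B_def pverts_corona)
  then have coal: "connected_coalition ?C A B" "connected_coalition ?C B A"
    using AB(1,2) by (auto simp: connected_coalition_def cds Un_commute Int_commute)
  have "partition_on (pverts ?C) {A, B}"
    using AB by (auto simp: partition_on_def disjoint_def)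
  then have ex: "connected_coalition_partition ?C {A, B}"
    using coal AB(3) by (auto simp: connected_coalition_partition_def)
  have uniq: "card \<Psi> = 2" if \<Psi>: "connected_coalition_partition ?C \<Psi>" for \<Psi>
  proof -
    have part: "partition_on (pverts ?C) \<Psi>"
      using \<Psi> by (simp add: connected_coalition_partition_def)
    \<comment> \<open>The corona has no full vertex, so the singleton alternative never
      applies.\<close>
    have partner: "\<exists>B \<in> \<Psi> - {A}. connected_coalition ?C A B" if "A \<in> \<Psi>" for A
      using that \<Psi> not_full_vertex_corona[OF GH H card]
      unfolding connected_coalition_partition_def by blast
    obtain P where P: "P \<in> \<Psi>"
      using part mem(1) by (auto simp: partition_on_def)
    obtain Q where Q: "Q \<in> \<Psi>" "Q \<noteq> P" and PQ: "connected_coalition ?C P Q"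
      using partner[OF P] by blast
    have "R \<in> {P, Q}" if R: "R \<in> \<Psi>" for R
    proof (rule ccontr)
      assume "R \<notin> {P, Q}"
      then have "R \<inter> (P \<union> Q) = {}"
        using part R P Q by (auto simp: partition_on_def disjoint_def)
      moreover obtain T where T: "connected_coalition ?C R T"
        using partner[OF R] by blast
      moreover have "Inl ` pverts G \<subseteq> P \<union> Q" "Inl ` pverts G \<subseteq> R \<union> T"
        using PQ T by (simp_all add: connected_coalition_def cds)
      \<comment> \<open>\<open>R\<close> misses the base, which \<open>P\<close> and
        \<open>Q\<close> exhaust. Hence \<open>T\<close> alone contains it and is connected
        dominating, which a coalition partner must not be.\<close>
      ultimately have "Inl ` pverts G \<subseteq> T"
        by blast
      then show False
        using T by (auto simp: connected_coalition_def cds)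
    qed
    then have "\<Psi> = {P, Q}" using P Q by blast
    then show ?thesis using Q by simp
  qed
  show ?thesis
    using CC_eqI[OF ex] uniq ex by metis
qed

section \<open>The corona of a single vertex\<close>

context
  fixes G :: "'a pair_pre_digraph" and H :: "'b pair_pre_digraph" and g :: 'a
  assumes G: "pair_graph G" and H: "pair_graph H" and G_eq: "pverts G = {g}"
    and H_nonempty: "pverts H \<noteq> {}"
begin

text \<open>With the base coordinate fixed, the only copy of \<open>H\<close> is the image of an
  injection, so notions of \<open>H\<close> and of the corona can be compared through
  images.\<close>

definition copy :: "'b \<Rightarrow> 'a + 'a \<times> 'b" where
  "copy h = Inr (g, h)"

lemma inj_copy: "inj copy"
  by (simp add: copy_def inj_def)

lemma pverts_corona_single: "pverts (corona G H) = insert (Inl g) (copy ` pverts H)"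
  by (auto simp: pverts_corona G_eq copy_def)

lemma copy_in_pverts_corona: "copy h \<in> pverts (corona G H) \<longleftrightarrow> h \<in> pverts H"
  by (auto simp: pverts_corona G_eq copy_def)

lemma parcs_corona_copy:
  "(copy h, copy h') \<in> parcs (corona G H) \<longleftrightarrow> (h, h') \<in> parcs H"
  "(Inl g, copy h) \<in> parcs (corona G H) \<longleftrightarrow> h \<in> pverts H"
  "(copy h, Inl g) \<in> parcs (corona G H) \<longleftrightarrow> h \<in> pverts H"
  by (auto simp: copy_def G_eq)

lemma Inl_neq_copy: "Inl g \<noteq> copy h" "copy h \<noteq> Inl g"
  by (auto simp: copy_def)

lemma full_vertex_corona_Inl: "full_vertex (corona G H) (Inl g)"
  by (auto simp: full_vertex_iff[OF pair_graph_corona[OF G H]] pverts_corona_single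
      parcs_corona_copy)

text \<open>The one new vertex to be checked is \<open>Inl g\<close>, and it is adjacent to the
  entire copy.\<close>

lemma full_vertex_corona_copy: "full_vertex (corona G H) (copy h) \<longleftrightarrow> full_vertex H h"
proof -
  have "pverts (corona G H) - {copy h} = insert (Inl g) (copy ` (pverts H - {h}))"
    by (auto simp: pverts_corona_single image_set_diff[OF inj_copy] Inl_neq_copy)
  then show ?thesis
    by (auto simp: full_vertex_iff[OF pair_graph_corona[OF G H]] full_vertex_iff[OF H]
        copy_in_pverts_corona parcs_corona_copy)
qed

lemma connected_dominating_set_corona_Inl:
  assumes "Inl g \<in> S" "S \<subseteq> pverts (corona G H)"
  shows "connected_dominating_set (corona G H) S"
proof (rule connected_dominating_set_corona_if_Inl_subset[OF G H])
  show "Digraph_Component.connected (with_proj G)"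
    using connected_induce_iff[OF G, of "pverts G"]
    unfolding induce_pverts[OF G] by (simp add: G_eq)
qed (use assms G_eq in auto)

text \<open>Only \<open>Inl g\<close> is added to the vertices to be dominated, and any member of
  the nonempty \<open>S\<close> dominates it. Connectedness transfers along the injection
  \<open>copy\<close>.\<close>

lemma connected_dominating_set_corona_copy:
  assumes "S \<noteq> {}"
  shows "connected_dominating_set (corona G H) (copy ` S) \<longleftrightarrow> connected_dominating_set H S"
proof -
  have "copy ` S \<subseteq> pverts (corona G H) \<longleftrightarrow> S \<subseteq> pverts H"
    by (auto simp: image_subset_iff copy_in_pverts_corona)
  moreover have "pverts (corona G H) - copy ` S = insert (Inl g) (copy ` (pverts H - S))"
    by (auto simp: pverts_corona_single image_set_diff[OF inj_copy] Inl_neq_copy)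
  moreover have "\<exists>u \<in> S. u \<in> pverts H" if "S \<subseteq> pverts H"
    using that assms by blast
  ultimately have "dominating_set (corona G H) (copy ` S) \<longleftrightarrow> dominating_set H S"
    by (auto simp: dominating_set_def parcs_corona_copy)
  moreover have "Digraph_Component.connected (with_proj (corona G H) \<restriction> copy ` S) \<longleftrightarrow>
      Digraph_Component.connected (with_proj H \<restriction> S)"
    unfolding connected_induce_iff[OF pair_graph_corona[OF G H]] connected_induce_iff[OF H]
    using rtrancl_on_image_iff[of copy S _ _ "parcs (corona G H)" "parcs H"]
      inj_on_subset[OF inj_copy subset_UNIV, of S]
    by (simp add: parcs_corona_copy)
  ultimately show ?thesis
    by (simp add: connected_dominating_set_def)
qed

lemma connected_coalition_corona_copy:
  assumes "A \<noteq> {}" "B \<noteq> {}"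
  shows "connected_coalition (corona G H) (copy ` A) (copy ` B) \<longleftrightarrow> connected_coalition H A B"
proof -
  have "connected_dominating_set (corona G H) (copy ` A \<union> copy ` B) \<longleftrightarrow>
      connected_dominating_set H (A \<union> B)"
    using connected_dominating_set_corona_copy[of "A \<union> B"] assms by (simp add: image_Un)
  moreover have "copy ` A \<inter> copy ` B = {} \<longleftrightarrow> A \<inter> B = {}"
    by (simp add: image_Int[OF inj_copy, symmetric])
  moreover have "copy ` A \<subseteq> pverts (corona G H) \<longleftrightarrow> A \<subseteq> pverts H" for A
    by (auto simp: image_subset_iff copy_in_pverts_corona)
  ultimately show ?thesis
    using connected_dominating_set_corona_copy assms by (simp add: connected_coalition_def)
qed

text \<open>The member containing \<open>Inl g\<close> would be connected dominating by itself. So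
  the block of \<open>Inl g\<close> has to qualify through the full vertex alternative.\<close>

lemma not_connected_coalition_corona_Inl:
  assumes "Inl g \<in> A \<union> B"
  shows "\<not> connected_coalition (corona G H) A B"
  using assms connected_dominating_set_corona_Inl by (auto simp: connected_coalition_def)

section \<open>Transfer of coalition partitions between \<open>H\<close> and the corona\<close>

lemma partition_on_corona_copy:
  "partition_on (pverts (corona G H)) (insert {Inl g} ((`) copy ` \<Phi>)) \<longleftrightarrow>
     partition_on (pverts H) \<Phi>"
proof -
  have disj: "disjnt {Inl g} (\<Union> ((`) copy ` \<Phi>))"
    by (auto simp: disjnt_def Inl_neq_copy)
  have "pverts (corona G H) - {Inl g} = copy ` pverts H"
    by (auto simp: pverts_corona_single Inl_neq_copy)
  then have "partition_on (pverts (corona G H)) (insert {Inl g} ((`) copy ` \<Phi>)) \<longleftrightarrow>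
      partition_on (copy ` pverts H) ((`) copy ` \<Phi>)"
    by (simp add: partition_on_insert[OF disj] pverts_corona_single)
  also have "\<dots> \<longleftrightarrow> partition_on (pverts H) \<Phi>"
  proof -
    \<comment> \<open>By injectivity, images under \<open>copy\<close> both preserve and reflect
      covering and disjointness.\<close>
    have "\<Union> ((`) copy ` \<Phi>) = copy ` pverts H \<longleftrightarrow> \<Union> \<Phi> = pverts H"
      by (metis image_Union inj_copy inj_image_eq_iff)
    moreover have "disjoint ((`) copy ` \<Phi>) \<longleftrightarrow> disjoint \<Phi>"
      by (auto simp: disjoint_def inj_image_eq_iff[OF inj_copy] image_Int[OF inj_copy, symmetric])
    ultimately show ?thesis
      by (auto simp: partition_on_def)
  qed
  finally show ?thesis .
qed

text \<open>The block \<open>{Inl g}\<close> qualifies as a full vertex. For the other blocks, full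
  vertices and coalition partners correspond under \<open>copy\<close>.\<close>

lemma connected_coalition_partition_corona_copy:
  "connected_coalition_partition (corona G H) (insert {Inl g} ((`) copy ` \<Phi>)) \<longleftrightarrow>
     connected_coalition_partition H \<Phi>"
proof (cases "partition_on (pverts H) \<Phi>")
  case True
  let ?\<Psi> = "insert {Inl g} ((`) copy ` \<Phi>)"
  have ne: "A \<noteq> {}" if "A \<in> \<Phi>" for A
    using that True by (auto simp: partition_on_def)
  have full: "(\<exists>v. full_vertex (corona G H) v \<and> copy ` A = {v}) \<longleftrightarrow>
      (\<exists>v. full_vertex H v \<and> A = {v})" if A: "A \<in> \<Phi>" for A
  proof
    assume "\<exists>v. full_vertex (corona G H) v \<and> copy ` A = {v}"
    then obtain v where v: "full_vertex (corona G H) v" "copy ` A = {v}" by blast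
    then obtain h where h: "h \<in> A" "v = copy h" by blast
    then have "A = {h}"
      using v(2) inj_copy by (metis image_empty image_insert inj_image_eq_iff)
    then show "\<exists>v. full_vertex H v \<and> A = {v}"
      using v(1) h full_vertex_corona_copy by blast
  next
    assume "\<exists>v. full_vertex H v \<and> A = {v}"
    then show "\<exists>v. full_vertex (corona G H) v \<and> copy ` A = {v}"
      using full_vertex_corona_copy by auto
  qed
  have coal: "(\<exists>B \<in> ?\<Psi> - {copy ` A}. connected_coalition (corona G H) (copy ` A) B) \<longleftrightarrow>
      (\<exists>B \<in> \<Phi> - {A}. connected_coalition H A B)" if A: "A \<in> \<Phi>" for A
  proof -
    let ?P = "connected_coalition (corona G H) (copy ` A)"
    have rest: "?\<Psi> - {copy ` A} - {{Inl g}} = (`) copy ` (\<Phi> - {A})"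
      using inj_image_eq_iff[OF inj_copy] Inl_neq_copy by blast
    have "\<not> ?P {Inl g}"
      by (simp add: not_connected_coalition_corona_Inl)
    then have "(\<exists>B \<in> ?\<Psi> - {copy ` A}. ?P B) \<longleftrightarrow>
        (\<exists>B \<in> ?\<Psi> - {copy ` A} - {{Inl g}}. ?P B)"
      by (metis Diff_iff singletonD)
    also have "\<dots> \<longleftrightarrow> (\<exists>B \<in> \<Phi> - {A}. ?P (copy ` B))"
      unfolding rest by blast
    also have "\<dots> \<longleftrightarrow> (\<exists>B \<in> \<Phi> - {A}. connected_coalition H A B)"
      using connected_coalition_corona_copy[OF ne[OF A] ne] by blast
    finally show ?thesis .
  qed
  show ?thesis
    using True full coal full_vertex_corona_Inl
    by (simp add: connected_coalition_partition_def partition_on_corona_copy)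
next
  case False
  then show ?thesis
    by (simp add: connected_coalition_partition_def partition_on_corona_copy)
qed

text \<open>The block of \<open>Inl g\<close> has no coalition partner, so it is a singleton. The
  other blocks avoid \<open>Inl g\<close>, hence lie in the copy and come from subsets of
  \<open>pverts H\<close>.\<close>

lemma connected_coalition_partition_corona_cases:
  assumes "connected_coalition_partition (corona G H) \<Psi>"
  obtains \<Phi> where "\<Psi> = insert {Inl g} ((`) copy ` \<Phi>)" "connected_coalition_partition H \<Phi>"
proof -
  have part: "partition_on (pverts (corona G H)) \<Psi>"
    using assms by (simp add: connected_coalition_partition_def)
  obtain A where A: "A \<in> \<Psi>" "Inl g \<in> A"
    using part by (auto simp: partition_on_def pverts_corona_single)
  then have "A = {Inl g}"
    using assms not_connected_coalition_corona_Inl[of A]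
    by (auto simp: connected_coalition_partition_def)
  then have mem: "{Inl g} \<in> \<Psi>" using A by simp
  have "B \<subseteq> copy ` pverts H" if "B \<in> \<Psi> - {{Inl g}}" for B
  proof -
    have "B \<inter> {Inl g} = {}" "B \<subseteq> pverts (corona G H)"
      using that part mem by (auto simp: partition_on_def dest: disjointD)
    then show ?thesis
      by (auto simp: pverts_corona_single)
  qed
  then have "\<Psi> - {{Inl g}} \<subseteq> (`) copy ` Pow (pverts H)"
    by (auto simp: image_Pow_surj[OF refl])
  then obtain \<Phi> where "\<Psi> - {{Inl g}} = (`) copy ` \<Phi>"
    by (meson subset_imageE)
  then have "\<Psi> = insert {Inl g} ((`) copy ` \<Phi>)"
    using mem by blast
  then show thesis
    using that assms connected_coalition_partition_corona_copy by blast
qed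

section \<open>Comparing the two coalition numbers\<close>

lemma card_insert_copy:
  assumes "connected_coalition_partition H \<Phi>"
  shows "card (insert {Inl g} ((`) copy ` \<Phi>)) = Suc (card \<Phi>)"
proof -
  interpret H: pair_graph H by (rule H)
  have "finite \<Phi>"
    using assms finite_elements[OF H.pair_finite_verts]
    by (simp add: connected_coalition_partition_def)
  \<comment> \<open>This new block is the summand 1 of the formula.\<close>
  moreover have "{Inl g} \<notin> (`) copy ` \<Phi>"
    by (auto simp: Inl_neq_copy set_eq_iff image_iff) (metis Inl_neq_copy(1))
  moreover have "card ((`) copy ` \<Phi>) = card \<Phi>"
    by (simp add: card_image inj_on_def inj_image_eq_iff[OF inj_copy])
  ultimately show ?thesis by simp
qed

text \<open>If partitions of \<open>H\<close> exist, the possible sizes for the corona are those for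
  \<open>H\<close> shifted by one, and the maximum shifts with them.\<close>

lemma CC_corona_single:
  "CC (corona G H) = (if CC H = 0 then 0 else 1 + CC H)"
proof (cases "\<exists>\<Phi>. connected_coalition_partition H \<Phi>")
  case True
  let ?M = "{card \<Phi> | \<Phi>. connected_coalition_partition H \<Phi>}"
  have "{card \<Psi> | \<Psi>. connected_coalition_partition (corona G H) \<Psi>} = Suc ` ?M"
  proof (intro subset_antisym subsetI)
    fix n assume "n \<in> {card \<Psi> | \<Psi>. connected_coalition_partition (corona G H) \<Psi>}"
    then show "n \<in> Suc ` ?M"
      using card_insert_copy by (auto elim!: connected_coalition_partition_corona_cases)
  next
    fix n assume "n \<in> Suc ` ?M"
    then obtain \<Phi> where "n = Suc (card \<Phi>)" "connected_coalition_partition H \<Phi>"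
      by blast
    then show "n \<in> {card \<Psi> | \<Psi>. connected_coalition_partition (corona G H) \<Psi>}"
      using card_insert_copy connected_coalition_partition_corona_copy
      by (intro CollectI exI[of _ "insert {Inl g} ((`) copy ` \<Phi>)"]) simp
  qed
  moreover have "Max (Suc ` ?M) = Suc (Max ?M)"
    using True finite_card_connected_coalition_partition[OF H]
    by (intro mono_Max_commute[symmetric]) (auto simp: mono_def)
  moreover have "\<exists>\<Psi>. connected_coalition_partition (corona G H) \<Psi>"
    using True connected_coalition_partition_corona_copy by blast
  ultimately have "CC (corona G H) = Suc (CC H)"
    using True by (simp add: CC_def)
  then show ?thesis
    using True CC_eq_0_iff[OF H H_nonempty] by auto
next
  case False
  \<comment> \<open>Here both numbers are the default 0, so the shift by one does not take
    place.\<close>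
  then have "\<not> (\<exists>\<Psi>. connected_coalition_partition (corona G H) \<Psi>)"
    using connected_coalition_partition_corona_cases by metis
  then show ?thesis
    using False CC_eq_0_iff[OF H H_nonempty] by (auto simp: CC_def)
qed

end

theorem corollary1p8:
  fixes G :: "'a pair_pre_digraph" and H :: "'b pair_pre_digraph"
  assumes "pair_graph G" and "pverts G \<noteq> {}" and "Digraph_Component.connected (with_proj G)"
    and "pair_graph H" and "pverts H \<noteq> {}"
  shows "(card (pverts G) \<ge> 2 \<longrightarrow> CC (corona G H) = 2) \<and>
         (card (pverts G) = 1 \<and> CC H = 0 \<longrightarrow> CC (corona G H) = 0) \<and>
         (card (pverts G) = 1 \<and> CC H \<noteq> 0 \<longrightarrow> CC (corona G H) = 1 + CC H)"
proof -
  have "CC (corona G H) = (if CC H = 0 then 0 else 1 + CC H)" if "card (pverts G) = 1"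
    using that CC_corona_single assms by (metis card_1_singletonE)
  then show ?thesis
    using CC_corona_if_two_le_card assms by auto
qed

end
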